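(* Let $G$ be a Polish or, more generally, a European topological group that is algebraically generated by a coarsely bounded set, and assume that $G$ has a minimal metric. Then $G$ has a metric that is simultaneously maximal and minimal, and hence $G$ has a well-defined Lipschitz geometric structure.
   Context: $1$ denotes the identity element of $G$. A metric on a topological group $G$ is compatible if it induces the topology of $G$, and left-invariant if $d(hg,hf)=d(g,f)$ for all $g,f,h\in G$. A metric $d$ on $G$ is minimal if it is compatible, left-invariant and, for every other compatible left-invariant metric $\partial$ on $G$, there are an identity neighbourhood $U$ and a constant $K$ (possibly depending on $\partial$) so that $d(g,f)\leqslant K\cdot\partial(g,f)$ for all $g,f\in U$. A compatible left-invariant metric $d$ on $G$ is maximal if, for every other compatible left-invariant metric $\partial$ on $G$, there are constants $K,C$ with $\partial\leqslant K\cdot d+C$. A topological group is Baire if the intersection of countably many dense open subsets is dense. A topological group $G$ is European if it is Baire and, for every identity neighbourhood $V$, there is a countable set $D\subseteq G$ so that $G=\langle V\cup D\rangle$ (every Polish group is European). A subset $B$ of a topological group $G$ is coarsely bounded if it has finite diameter with respect to every continuous left-invariant pseudometric on $G$. That $G$ has a well-defined Lipschitz geometric structure means that $G$ admits a metric that is simultaneously minimal and maximal and that any two such metrics $d,\partial$ on $G$ are bi-Lipschitz equivalent, i.e., $\frac1L\cdot d\leqslant\partial\leqslant L\cdot d$ for some constant $L$. *)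

theory Defs
  imports "HOL-Analysis.Analysis" "HOL-Algebra.Generated_Groups"
begin

locale topological_group = group G for G :: "('a, 'b) monoid_scheme" (structure) +
  fixes T :: "'a topology"
  assumes topspace_carrier: "topspace T = carrier G"
    and continuous_mult: "continuous_map (prod_topology T T) T (\<lambda>(x, y). x \<otimes> y)"
    and continuous_inv: "continuous_map T T (\<lambda>x. inv x)"

definition identity_neighbourhood ::
    "('a, 'b) monoid_scheme \<Rightarrow> 'a topology \<Rightarrow> 'a set \<Rightarrow> bool" where
  "identity_neighbourhood G T V \<longleftrightarrow>
     V \<subseteq> carrier G \<and> (\<exists>U. openin T U \<and> \<one>\<^bsub>G\<^esub> \<in> U \<and> U \<subseteq> V)"

text \<open>The intersection is taken inside the space, so that the empty family
  contributes the whole space rather than the whole type.\<close>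

definition baire_space :: "'a topology \<Rightarrow> bool" where
  "baire_space T \<longleftrightarrow>
     (\<forall>\<U>. countable \<U> \<and> (\<forall>U\<in>\<U>. openin T U \<and> T closure_of U = topspace T) \<longrightarrow>
          T closure_of (topspace T \<inter> \<Inter>\<U>) = topspace T)"

locale polish_group = topological_group +
  assumes separable: "separable_space T"
    and completely_metrizable: "completely_metrizable_space T"

locale european_group = topological_group +
  assumes baire: "baire_space T"
    and countably_generated_over_neighbourhoods:
      "\<And>V. identity_neighbourhood G T V \<Longrightarrow>
         \<exists>D. countable D \<and> D \<subseteq> carrier G \<and> generate G (V \<union> D) = carrier G"

text \<open>Metrics and pseudometrics on a group are real-valued functions on the whole type
  of which only the values on the carrier matter; all comparisons between them
  are restricted to the carrier.\<close>

definition left_invariant ::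
    "('a, 'b) monoid_scheme \<Rightarrow> ('a \<Rightarrow> 'a \<Rightarrow> real) \<Rightarrow> bool" where
  "left_invariant G d \<longleftrightarrow>
     (\<forall>g\<in>carrier G. \<forall>f\<in>carrier G. \<forall>h\<in>carrier G.
        d (h \<otimes>\<^bsub>G\<^esub> g) (h \<otimes>\<^bsub>G\<^esub> f) = d g f)"

definition compatible_metric ::
    "('a, 'b) monoid_scheme \<Rightarrow> 'a topology \<Rightarrow> ('a \<Rightarrow> 'a \<Rightarrow> real) \<Rightarrow> bool" where
  "compatible_metric G T d \<longleftrightarrow>
     Metric_space (carrier G) d \<and> Metric_space.mtopology (carrier G) d = T"

definition minimal_metric ::
    "('a, 'b) monoid_scheme \<Rightarrow> 'a topology \<Rightarrow> ('a \<Rightarrow> 'a \<Rightarrow> real) \<Rightarrow> bool" where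
  "minimal_metric G T d \<longleftrightarrow>
     compatible_metric G T d \<and> left_invariant G d \<and>
     (\<forall>\<delta>. compatible_metric G T \<delta> \<and> left_invariant G \<delta> \<longrightarrow>
        (\<exists>U K. identity_neighbourhood G T U \<and> (\<forall>g\<in>U. \<forall>f\<in>U. d g f \<le> K * \<delta> g f)))"

definition maximal_metric ::
    "('a, 'b) monoid_scheme \<Rightarrow> 'a topology \<Rightarrow> ('a \<Rightarrow> 'a \<Rightarrow> real) \<Rightarrow> bool" where
  "maximal_metric G T d \<longleftrightarrow>
     compatible_metric G T d \<and> left_invariant G d \<and>
     (\<forall>\<delta>. compatible_metric G T \<delta> \<and> left_invariant G \<delta> \<longrightarrow>
        (\<exists>K C. \<forall>g\<in>carrier G. \<forall>f\<in>carrier G. \<delta> g f \<le> K * d g f + C))"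

definition pseudometric_on :: "'a set \<Rightarrow> ('a \<Rightarrow> 'a \<Rightarrow> real) \<Rightarrow> bool" where
  "pseudometric_on M d \<longleftrightarrow>
     (\<forall>x\<in>M. \<forall>y\<in>M. 0 \<le> d x y) \<and>
     (\<forall>x\<in>M. d x x = 0) \<and>
     (\<forall>x\<in>M. \<forall>y\<in>M. d x y = d y x) \<and>
     (\<forall>x\<in>M. \<forall>y\<in>M. \<forall>z\<in>M. d x z \<le> d x y + d y z)"

definition coarsely_bounded ::
    "('a, 'b) monoid_scheme \<Rightarrow> 'a topology \<Rightarrow> 'a set \<Rightarrow> bool" where
  "coarsely_bounded G T B \<longleftrightarrow>
     B \<subseteq> carrier G \<and>
     (\<forall>d. pseudometric_on (carrier G) d \<and> left_invariant G d \<and>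
          continuous_map (prod_topology T T) euclideanreal (\<lambda>(x, y). d x y) \<longrightarrow>
          (\<exists>C. \<forall>x\<in>B. \<forall>y\<in>B. d x y \<le> C))"

definition bi_Lipschitz_equivalent_on ::
    "'a set \<Rightarrow> ('a \<Rightarrow> 'a \<Rightarrow> real) \<Rightarrow> ('a \<Rightarrow> 'a \<Rightarrow> real) \<Rightarrow> bool" where
  "bi_Lipschitz_equivalent_on M d \<delta> \<longleftrightarrow>
     (\<exists>L>0. \<forall>x\<in>M. \<forall>y\<in>M. 1 / L * d x y \<le> \<delta> x y \<and> \<delta> x y \<le> L * d x y)"

definition well_defined_Lipschitz_geometry ::
    "('a, 'b) monoid_scheme \<Rightarrow> 'a topology \<Rightarrow> bool" where
  "well_defined_Lipschitz_geometry G T \<longleftrightarrow>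
     (\<exists>d. minimal_metric G T d \<and> maximal_metric G T d) \<and>
     (\<forall>d \<delta>. minimal_metric G T d \<and> maximal_metric G T d \<and>
             minimal_metric G T \<delta> \<and> maximal_metric G T \<delta> \<longrightarrow>
             bi_Lipschitz_equivalent_on (carrier G) d \<delta>)"

end

theory Submission
  imports Defs
begin

text \<open>
  Uniqueness holds in every topological group. If \<open>d\<close> is minimal and \<open>\<delta>\<close> is maximal, then
  \<open>d \<le> K \<cdot> \<delta>\<close> between points at \<open>\<delta>\<close>-distance less than some \<open>e > 0\<close>, while at distances of
  at least \<open>e\<close> the additive constant in \<open>d \<le> K \<cdot> \<delta> + C\<close> is absorbed into the multiplicative
  one. So \<open>d \<le> L \<cdot> \<delta>\<close> everywhere, and by symmetry two metrics that are both minimal and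
  maximal are bi-Lipschitz equivalent.

  For existence, let \<open>d\<close> be a minimal metric and let \<open>B\<close> be a coarsely bounded generating set.
  The sets \<open>A n\<close> of products of at most \<open>n\<close> elements of \<open>B\<close> and their inverses cover \<open>G\<close>,
  so by Baire the closure of some \<open>A n\<close> has an interior point. Every compatible left-invariant
  metric is bounded on \<open>A n\<close>, hence on its closure, hence on a fixed \<open>d\<close>-ball of some radius
  \<open>e\<close> about the identity. Therefore the symmetric generating set \<open>W\<close> obtained by adding this
  ball to \<open>B\<close> and its inverses is still bounded for every such metric.

  Now replace \<open>d\<close> by the largest left-invariant metric \<open>D\<close> with \<open>D 1 w \<le> d 1 w\<close> for \<open>w\<close> in
  \<open>W\<close>, that is, let \<open>D 1 g\<close> be the infimum of the sums of the \<open>d 1 w\<^sub>i\<close> over all ways of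
  writing \<open>g\<close> as a product of elements \<open>w\<^sub>i\<close> of \<open>W\<close>. Since \<open>W\<close> contains a ball, \<open>D\<close> agrees
  with \<open>d\<close> at small distances, so it is compatible and minimal. It is maximal because in a
  product of elements of \<open>W\<close> neighbouring factors can be merged as long as their norms add up
  to less than \<open>e\<close>; after this the number of factors is at most a constant times the cost plus a
  constant, and each factor has bounded norm for any given metric
  (lemma \<open>norm_le_of_word_cost\<close>).

  The Baire property is part of the definition of European groups; Polish groups have it by the
  Baire category theorem.
\<close>

section \<open>Left-invariant metrics\<close>

locale left_invariant_metric_group =
  group G + Metric_space "carrier G" d
  for G :: "('a, 'b) monoid_scheme" (structure) and d :: "'a \<Rightarrow> 'a \<Rightarrow> real" +
  assumes left_inv: "left_invariant G d"
begin

lemma dist_mult_left: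
  "\<lbrakk>h \<in> carrier G; g \<in> carrier G; f \<in> carrier G\<rbrakk> \<Longrightarrow> d (h \<otimes> g) (h \<otimes> f) = d g f"
  using left_inv by (simp add: left_invariant_def)

lemma dist_eq_norm:
  assumes "g \<in> carrier G" "f \<in> carrier G"
  shows "d g f = d \<one> (inv g \<otimes> f)"
  using dist_mult_left[of "inv g" g f] assms by simp

lemma norm_inv:
  assumes "g \<in> carrier G"
  shows "d \<one> (inv g) = d \<one> g"
  using dist_eq_norm[of g \<one>] assms by (simp add: commute)

lemma norm_mult:
  assumes "g \<in> carrier G" "f \<in> carrier G"
  shows "d \<one> (g \<otimes> f) \<le> d \<one> g + d \<one> f"
  using triangle[of \<one> g "g \<otimes> f"] dist_mult_left[of g \<one> f] assms by simp

end

lemma left_invariant_metric_groupI: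
  assumes "group G" "compatible_metric G T d" "left_invariant G d"
  shows "left_invariant_metric_group G d"
  using assms
  by (simp add: left_invariant_metric_group_def left_invariant_metric_group_axioms_def
      compatible_metric_def)

text \<open>Compatibility of a metric depends only on its values at small distances.\<close>

lemma mtopology_eq_of_locally_eq:
  assumes "Metric_space M d" "Metric_space M D" and "e > 0"
    and le: "\<And>x y. \<lbrakk>x \<in> M; y \<in> M\<rbrakk> \<Longrightarrow> d x y \<le> D x y"
    and eq: "\<And>x y. \<lbrakk>x \<in> M; y \<in> M; d x y < e\<rbrakk> \<Longrightarrow> D x y = d x y"
  shows "Metric_space.mtopology M D = Metric_space.mtopology M d"
proof -
  interpret d: Metric_space M d by fact
  interpret D: Metric_space M D by fact
  have sub1: "D.mball x r \<subseteq> d.mball x r" for x r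
    by (auto intro: le_less_trans[OF le])
  have sub2: "d.mball x (min r e) \<subseteq> D.mball x r" for x r
    using eq by auto
  have "openin D.mtopology U \<longleftrightarrow> openin d.mtopology U" for U
    unfolding D.openin_mtopology d.openin_mtopology
    using sub1 sub2 \<open>e > 0\<close> by (metis min_less_iff_conj order_trans)
  then show ?thesis
    by (simp add: topology_eq)
qed

section \<open>Costs of words\<close>

text \<open>\<open>word_cost G S c g r\<close> says that \<open>g\<close> is a product of elements of \<open>S\<close> whose costs,
  given by \<open>c\<close>, add up to \<open>r\<close>. A word may be empty, and the same \<open>g\<close> may have many costs. With
  constant cost \<open>1\<close> this is word length; with \<open>c = d \<one>\<close> it is the length of a chain of steps
  from \<open>\<one>\<close> to \<open>g\<close>.\<close>

inductive word_cost ::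
    "('a, 'b) monoid_scheme \<Rightarrow> 'a set \<Rightarrow> ('a \<Rightarrow> real) \<Rightarrow> 'a \<Rightarrow> real \<Rightarrow> bool"
  for G and S and c where
  word_cost_one: "word_cost G S c \<one>\<^bsub>G\<^esub> 0"
| word_cost_snoc: "\<lbrakk>word_cost G S c g r; s \<in> S\<rbrakk> \<Longrightarrow> word_cost G S c (g \<otimes>\<^bsub>G\<^esub> s) (r + c s)"

context group
begin

lemma word_cost_closed:
  assumes "word_cost G S c g r" "S \<subseteq> carrier G"
  shows "g \<in> carrier G"
  using assms by (induction rule: word_cost.induct) auto

lemma word_cost_single:
  assumes "s \<in> S" "S \<subseteq> carrier G"
  shows "word_cost G S c s (c s)"
  using word_cost_snoc[OF word_cost_one assms(1), of G c] assms by (simp add: subsetD)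

lemma word_cost_mult:
  assumes "word_cost G S c h s" "word_cost G S c g r" "S \<subseteq> carrier G"
  shows "word_cost G S c (g \<otimes> h) (r + s)"
  using assms
proof (induction rule: word_cost.induct)
  case word_cost_one
  then show ?case by (simp add: word_cost_closed)
next
  case (word_cost_snoc h s x)
  have "h \<in> carrier G" "g \<in> carrier G" "x \<in> carrier G"
    using word_cost_snoc word_cost_closed by auto
  then show ?case
    using word_cost.word_cost_snoc[OF word_cost_snoc.IH[OF word_cost_snoc.prems]
        word_cost_snoc.hyps(2)]
    by (simp add: m_assoc add.assoc)
qed

lemma word_cost_inv:
  assumes "word_cost G S c g r" "S \<subseteq> carrier G"
    and sym: "\<And>s. s \<in> S \<Longrightarrow> inv s \<in> S \<and> c (inv s) = c s"
  shows "word_cost G S c (inv g) r"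
  using assms(1,2)
proof (induction rule: word_cost.induct)
  case word_cost_one
  then show ?case by (simp add: word_cost.word_cost_one)
next
  case (word_cost_snoc g r s)
  have "g \<in> carrier G" "s \<in> carrier G"
    using word_cost_snoc word_cost_closed by auto
  moreover have "word_cost G S c (inv s) (c s)"
    using word_cost_single[of "inv s" S c] sym[OF word_cost_snoc.hyps(2)] word_cost_snoc.prems
    by simp
  ultimately show ?case
    using word_cost_mult[OF word_cost_snoc.IH[OF word_cost_snoc.prems] _ word_cost_snoc.prems,
        of "inv s" "c s"]
    by (simp add: inv_mult_group add.commute)
qed

lemma word_cost_total:
  assumes "g \<in> generate G S" "S \<subseteq> carrier G" and sym: "\<And>s. s \<in> S \<Longrightarrow> inv s \<in> S"
  shows "\<exists>r. word_cost G S c g r"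
  using assms(1,2)
proof (induction rule: generate.induct)
  case one
  then show ?case using word_cost_one by blast
next
  case (incl h)
  then show ?case using word_cost_single by blast
next
  case (inv h)
  then show ?case using word_cost_single sym by blast
next
  case (eng h1 h2)
  then show ?case using word_cost_mult by blast
qed

end

lemma word_cost_nonneg:
  assumes "word_cost G S c g r" "\<And>s. s \<in> S \<Longrightarrow> 0 \<le> c s"
  shows "0 \<le> r"
  using assms by (induction rule: word_cost.induct) auto

lemma (in left_invariant_metric_group) norm_le_word_cost:
  assumes "word_cost G S c g r" "S \<subseteq> carrier G"
    and "\<And>s. s \<in> S \<Longrightarrow> d \<one> s \<le> K * c s"
  shows "d \<one> g \<le> K * r"
  using assms(1,2)
proof (induction rule: word_cost.induct)
  case word_cost_one
  then show ?case by simp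
next
  case (word_cost_snoc g r s)
  have "g \<in> carrier G" "s \<in> carrier G"
    using word_cost_snoc word_cost_closed by auto
  then show ?case
    using norm_mult[of g s] word_cost_snoc.IH[OF word_cost_snoc.prems]
      assms(3)[OF word_cost_snoc.hyps(2)]
    by (simp add: distrib_left)
qed

section \<open>The chain metric\<close>

text \<open>A symmetric generating set \<open>W\<close> that contains a \<open>d\<close>-ball about the identity. The other
  elements of \<open>W\<close> may be arbitrarily far from the identity.\<close>

locale chain_metric = left_invariant_metric_group +
  fixes W :: "'a set" and e :: real
  assumes W_carrier: "W \<subseteq> carrier G"
    and W_inv: "\<And>w. w \<in> W \<Longrightarrow> inv w \<in> W"
    and W_generate: "generate G W = carrier G"
    and e_pos: "e > 0"
    and ball_W: "mball \<one> e \<subseteq> W"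
begin

abbreviation cost :: "'a \<Rightarrow> real \<Rightarrow> bool" where
  "cost \<equiv> word_cost G W (d \<one>)"

definition chain_norm :: "'a \<Rightarrow> real" where
  "chain_norm g = Inf {r. cost g r}"

text \<open>The largest left-invariant metric that is bounded by \<open>d\<close> on pairs of points differing
  by an element of \<open>W\<close>. The value \<open>0\<close> off the carrier makes it nonnegative and symmetric on
  the whole type, as \<^locale>\<open>Metric_space\<close> demands.\<close>

definition chain_dist :: "'a \<Rightarrow> 'a \<Rightarrow> real" where
  "chain_dist x y = (if x \<in> carrier G \<and> y \<in> carrier G then chain_norm (inv x \<otimes> y) else 0)"

lemma ex_cost: "g \<in> carrier G \<Longrightarrow> \<exists>r. cost g r"
  using word_cost_total[of g W] W_generate W_carrier W_inv by auto

lemma cost_closed: "cost g r \<Longrightarrow> g \<in> carrier G"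
  using word_cost_closed W_carrier by blast

lemma chain_norm_le: "cost g r \<Longrightarrow> chain_norm g \<le> r"
  unfolding chain_norm_def
  by (rule cInf_lower) (auto intro!: bdd_belowI[of _ 0] elim: word_cost_nonneg)

lemma chain_norm_greatest:
  "\<lbrakk>g \<in> carrier G; \<And>r. cost g r \<Longrightarrow> a \<le> r\<rbrakk> \<Longrightarrow> a \<le> chain_norm g"
  unfolding chain_norm_def using ex_cost by (intro cInf_greatest) auto

lemma norm_le_chain_norm: "g \<in> carrier G \<Longrightarrow> d \<one> g \<le> chain_norm g"
  using norm_le_word_cost[of W "d \<one>" g _ 1] W_carrier by (intro chain_norm_greatest) auto

lemma chain_norm_eq: "w \<in> W \<Longrightarrow> chain_norm w = d \<one> w"
  using W_carrier
  by (intro antisym norm_le_chain_norm chain_norm_le word_cost_single) auto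

lemma chain_norm_inv_le: "g \<in> carrier G \<Longrightarrow> chain_norm (inv g) \<le> chain_norm g"
  using W_carrier W_inv
  by (intro chain_norm_greatest chain_norm_le word_cost_inv) (auto simp: norm_inv subsetD)

lemma chain_norm_inv: "g \<in> carrier G \<Longrightarrow> chain_norm (inv g) = chain_norm g"
  using chain_norm_inv_le[of g] chain_norm_inv_le[of "inv g"] by simp

lemma chain_norm_mult:
  assumes "g \<in> carrier G" "h \<in> carrier G"
  shows "chain_norm (g \<otimes> h) \<le> chain_norm g + chain_norm h"
proof -
  have "chain_norm (g \<otimes> h) - r \<le> chain_norm h" if "cost g r" for r
    using chain_norm_le[OF word_cost_mult[OF _ that W_carrier]] assms
    by (intro chain_norm_greatest) (auto simp: algebra_simps)
  then have "chain_norm (g \<otimes> h) - chain_norm h \<le> chain_norm g"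
    using assms by (intro chain_norm_greatest) (auto simp: algebra_simps)
  then show ?thesis by simp
qed

lemma chain_dist_ge: "\<lbrakk>x \<in> carrier G; y \<in> carrier G\<rbrakk> \<Longrightarrow> d x y \<le> chain_dist x y"
  by (simp add: chain_dist_def norm_le_chain_norm dist_eq_norm[of x y])

lemma chain_dist_eq:
  assumes "x \<in> carrier G" "y \<in> carrier G" "d x y < e"
  shows "chain_dist x y = d x y"
proof -
  have "inv x \<otimes> y \<in> W"
    using assms ball_W dist_eq_norm[of x y] by auto
  then show ?thesis
    using assms chain_norm_eq dist_eq_norm[of x y] by (simp add: chain_dist_def)
qed

lemma Metric_space_chain_dist: "Metric_space (carrier G) chain_dist"
proof
  show "0 \<le> chain_dist x y" for x y
    using order.trans[OF nonneg chain_dist_ge] by (cases "x \<in> carrier G \<and> y \<in> carrier G")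
      (auto simp: chain_dist_def)
  show "chain_dist x y = chain_dist y x" for x y
    using chain_norm_inv[of "inv x \<otimes> y"] by (auto simp: chain_dist_def inv_mult_group)
  show "chain_dist x y = 0 \<longleftrightarrow> x = y" if "x \<in> carrier G" "y \<in> carrier G" for x y
  proof
    assume "chain_dist x y = 0"
    then have "d x y = 0"
      using chain_dist_ge[of x y] nonneg[of x y] that by linarith
    then show "x = y"
      using that by simp
  next
    assume "x = y"
    then show "chain_dist x y = 0"
      using chain_dist_eq[of x x] that e_pos by simp
  qed
  show "chain_dist x z \<le> chain_dist x y + chain_dist y z"
    if "x \<in> carrier G" "y \<in> carrier G" "z \<in> carrier G" for x y z
  proof -
    have "(inv x \<otimes> y) \<otimes> (inv y \<otimes> z) = inv x \<otimes> z"
      using that m_assoc[of y "inv y" z] by (simp add: m_assoc)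
    then show ?thesis
      using that chain_norm_mult[of "inv x \<otimes> y" "inv y \<otimes> z"] by (simp add: chain_dist_def)
  qed
qed

lemma left_invariant_chain_dist: "left_invariant G chain_dist"
  unfolding left_invariant_def
proof (intro ballI)
  fix g f h assume *: "g \<in> carrier G" "f \<in> carrier G" "h \<in> carrier G"
  then have "inv (h \<otimes> g) \<otimes> (h \<otimes> f) = inv g \<otimes> f"
    by (simp add: inv_mult_group m_assoc inv_solve_left')
  then show "chain_dist (h \<otimes> g) (h \<otimes> f) = chain_dist g f"
    using * by (simp add: chain_dist_def)
qed

lemma compatible_chain_dist: "compatible_metric G mtopology chain_dist"
  unfolding compatible_metric_def
  using mtopology_eq_of_locally_eq[OF Metric_space_axioms Metric_space_chain_dist e_pos]
    Metric_space_chain_dist chain_dist_ge chain_dist_eq by blast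

lemma minimal_chain_dist:
  assumes "minimal_metric G mtopology d"
  shows "minimal_metric G mtopology chain_dist"
  unfolding minimal_metric_def
proof (intro conjI allI impI compatible_chain_dist left_invariant_chain_dist)
  fix \<delta> assume "compatible_metric G mtopology \<delta> \<and> left_invariant G \<delta>"
  then obtain U K where U: "identity_neighbourhood G mtopology U"
    and K: "\<And>g f. \<lbrakk>g \<in> U; f \<in> U\<rbrakk> \<Longrightarrow> d g f \<le> K * \<delta> g f"
    using assms unfolding minimal_metric_def by blast
  obtain N where N: "openin mtopology N" "\<one> \<in> N" "N \<subseteq> U" and "U \<subseteq> carrier G"
    using U unfolding identity_neighbourhood_def by blast
  let ?V = "U \<inter> mball \<one> (e / 2)"
  have "openin mtopology (N \<inter> mball \<one> (e / 2))"
    using N by blast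
  then have "identity_neighbourhood G mtopology ?V"
    unfolding identity_neighbourhood_def
    using N e_pos by (intro conjI exI[of _ "N \<inter> mball \<one> (e / 2)"]) auto
  moreover have "chain_dist g f \<le> K * \<delta> g f" if "g \<in> ?V" "f \<in> ?V" for g f
  proof -
    have "g \<in> carrier G" "f \<in> carrier G"
      using that by auto
    moreover from this have "d g f < e"
      using that triangle''[of g \<one> f] by auto
    ultimately show ?thesis
      using K[of g f] that by (simp add: chain_dist_eq)
  qed
  ultimately show "\<exists>U K. identity_neighbourhood G mtopology U \<and>
      (\<forall>g\<in>U. \<forall>f\<in>U. chain_dist g f \<le> K * \<delta> g f)"
    by blast
qed

text \<open>The merging argument. Reading the word from the left, its product is kept in the form
  \<open>q \<otimes> u\<close> with a last factor \<open>u\<close> in the ball. A new letter is merged into \<open>u\<close> if the two norms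
  add up to less than \<open>e\<close>; otherwise \<open>u\<close> and the letter are moved into \<open>q\<close>, which adds at most \<open>2 * M\<close>
  to the \<open>\<delta>\<close>-norm of \<open>q\<close> and is paid for by a cost of at least \<open>e\<close>.\<close>

lemma word_cost_split:
  assumes \<delta>: "left_invariant_metric_group G \<delta>"
    and "M > 0" and M: "\<And>w. w \<in> W \<Longrightarrow> \<delta> \<one> w \<le> M"
    and "cost g r"
  shows "\<exists>q u. q \<in> carrier G \<and> u \<in> mball \<one> e \<and> g = q \<otimes> u \<and>
    \<delta> \<one> q \<le> 2 * M / e * (r - d \<one> u)"
  using \<open>cost g r\<close>
proof (induction rule: word_cost.induct)
  case word_cost_one
  interpret \<delta>: left_invariant_metric_group G \<delta> by fact
  show ?case
    using e_pos by (intro exI[of _ \<one>]) auto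
next
  case (word_cost_snoc g r w)
  interpret \<delta>: left_invariant_metric_group G \<delta> by fact
  obtain q u where q: "q \<in> carrier G" and u: "u \<in> mball \<one> e" and g: "g = q \<otimes> u"
    and le: "\<delta> \<one> q \<le> 2 * M / e * (r - d \<one> u)"
    using word_cost_snoc.IH by blast
  have closed: "u \<in> carrier G" "w \<in> carrier G"
    using u W_carrier word_cost_snoc by auto
  show ?case
  proof (cases "d \<one> u + d \<one> w < e")
    case True
    have uw: "d \<one> (u \<otimes> w) \<le> d \<one> u + d \<one> w"
      using norm_mult closed by blast
    have "2 * M / e * (r - d \<one> u) \<le> 2 * M / e * (r + d \<one> w - d \<one> (u \<otimes> w))"
      using uw \<open>M > 0\<close> e_pos by (intro mult_left_mono) auto
    then show ?thesis
      using q u g le closed uw True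
      by (intro exI[of _ q] exI[of _ "u \<otimes> w"]) (auto simp: m_assoc)
  next
    case False
    have "2 * M = 2 * M / e * e"
      using e_pos by simp
    also have "\<dots> \<le> 2 * M / e * (d \<one> u + d \<one> w)"
      using False \<open>M > 0\<close> e_pos by (intro mult_left_mono) auto
    finally have pay: "2 * M \<le> 2 * M / e * (d \<one> u + d \<one> w)" .
    have "\<delta> \<one> (q \<otimes> u \<otimes> w) \<le> \<delta> \<one> q + \<delta> \<one> u + \<delta> \<one> w"
      using \<delta>.norm_mult[of "q \<otimes> u" w] \<delta>.norm_mult[of q u] q closed by simp
    also have "\<dots> \<le> 2 * M / e * (r - d \<one> u) + M + M"
      using le M[of u] M[of w] u ball_W word_cost_snoc.hyps by (intro add_mono) auto
    also have "\<dots> \<le> 2 * M / e * (r - d \<one> u) + 2 * M / e * (d \<one> u + d \<one> w)"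
      using pay by simp
    also have "\<dots> = 2 * M / e * (r + d \<one> w - d \<one> \<one>)"
      by (simp add: algebra_simps flip: add_divide_distrib)
    finally show ?thesis
      using q g closed e_pos by (intro exI[of _ "q \<otimes> u \<otimes> w"] exI[of _ \<one>]) auto
  qed
qed

lemma norm_le_of_word_cost:
  assumes \<delta>: "left_invariant_metric_group G \<delta>"
    and "M > 0" and M: "\<And>w. w \<in> W \<Longrightarrow> \<delta> \<one> w \<le> M"
    and "cost g r"
  shows "\<delta> \<one> g \<le> 2 * M / e * r + M"
proof -
  interpret \<delta>: left_invariant_metric_group G \<delta> by fact
  obtain q u where q: "q \<in> carrier G" and u: "u \<in> mball \<one> e" and g: "g = q \<otimes> u"
    and le: "\<delta> \<one> q \<le> 2 * M / e * (r - d \<one> u)"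
    using word_cost_split[OF assms] by blast
  have "\<delta> \<one> g \<le> \<delta> \<one> q + \<delta> \<one> u"
    using g q u \<delta>.norm_mult by auto
  also have "\<dots> \<le> 2 * M / e * (r - d \<one> u) + M"
    using le M[of u] u ball_W by (intro add_mono) auto
  also have "\<dots> \<le> 2 * M / e * r + M"
    using \<open>M > 0\<close> e_pos by (intro add_mono mult_left_mono) auto
  finally show ?thesis .
qed

lemma maximal_chain_dist:
  assumes bdd: "\<And>\<delta>. \<lbrakk>compatible_metric G mtopology \<delta>; left_invariant G \<delta>\<rbrakk> \<Longrightarrow>
    \<exists>M. \<forall>w\<in>W. \<delta> \<one> w \<le> M"
  shows "maximal_metric G mtopology chain_dist"
  unfolding maximal_metric_def
proof (intro conjI allI impI compatible_chain_dist left_invariant_chain_dist)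
  fix \<delta> assume *: "compatible_metric G mtopology \<delta> \<and> left_invariant G \<delta>"
  then have \<delta>: "left_invariant_metric_group G \<delta>"
    using left_invariant_metric_groupI is_group by blast
  then interpret \<delta>: left_invariant_metric_group G \<delta> .
  obtain M0 where M0: "\<And>w. w \<in> W \<Longrightarrow> \<delta> \<one> w \<le> M0"
    using bdd * by blast
  define M where "M = max M0 1"
  have M: "M > 0" "\<And>w. w \<in> W \<Longrightarrow> \<delta> \<one> w \<le> M"
    using M0 by (auto simp: M_def le_max_iff_disj)
  have "\<delta> g f \<le> 2 * M / e * chain_dist g f + M" if "g \<in> carrier G" "f \<in> carrier G" for g f
  proof -
    let ?x = "inv g \<otimes> f"
    have x: "?x \<in> carrier G"
      using that by simp
    have "(\<delta> \<one> ?x - M) * e / (2 * M) \<le> chain_norm ?x"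
      using norm_le_of_word_cost[OF \<delta> M] M(1) e_pos x
      by (intro chain_norm_greatest) (auto simp: field_simps)
    then show ?thesis
      using M(1) e_pos that \<delta>.dist_eq_norm[of g f] by (simp add: chain_dist_def field_simps)
  qed
  then show "\<exists>K C. \<forall>g\<in>carrier G. \<forall>f\<in>carrier G. \<delta> g f \<le> K * chain_dist g f + C"
    by blast
qed

end

section \<open>Boundedness near the identity\<close>

lemma polish_group_imp_baire_space:
  assumes "polish_group G T"
  shows "baire_space T"
  unfolding baire_space_def
proof (intro allI impI)
  fix \<U> assume \<U>: "countable \<U> \<and> (\<forall>U\<in>\<U>. openin T U \<and> T closure_of U = topspace T)"
  have "T closure_of \<Inter>\<U> = topspace T"
    using Baire_category[of T \<U>] polish_group.completely_metrizable[OF assms] \<U> by blast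
  then show "T closure_of (topspace T \<inter> \<Inter>\<U>) = topspace T"
    by (metis closure_of_restrict)
qed

lemma coarsely_bounded_imp_norm_bounded:
  fixes G (structure)
  assumes "group G" "coarsely_bounded G T B" "compatible_metric G T d" "left_invariant G d"
  shows "\<exists>C. \<forall>x\<in>B. d \<one> x \<le> C"
proof -
  interpret left_invariant_metric_group G d
    using left_invariant_metric_groupI assms by blast
  have T: "mtopology = T"
    using assms(3) by (simp add: compatible_metric_def)
  have "pseudometric_on (carrier G) d"
    by (simp add: pseudometric_on_def commute triangle)
  moreover have "continuous_map (prod_topology T T) euclideanreal (\<lambda>(x, y). d x y)"
    using continuous_map_metric[of "metric (carrier G, d)"] T
    by (simp add: mtopology_of_def)
  ultimately obtain C where "\<And>x y. \<lbrakk>x \<in> B; y \<in> B\<rbrakk> \<Longrightarrow> d x y \<le> C" and B: "B \<subseteq> carrier G"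
    using assms(2,4) unfolding coarsely_bounded_def by blast
  then have "d \<one> x \<le> d \<one> b + C" if "b \<in> B" "x \<in> B" for b x
    using triangle[of \<one> b x] that by (smt (verit) one_closed subsetD)
  then show ?thesis
    by (cases "B = {}") blast+
qed

lemma baire_space_countable_cover:
  assumes "baire_space T" "topspace T \<noteq> {}" "topspace T = (\<Union>n::nat. A n)"
  shows "\<exists>n. T interior_of (T closure_of A n) \<noteq> {}"
proof (rule ccontr)
  assume "\<not> ?thesis"
  then have "T closure_of (topspace T - T closure_of A n) = topspace T" for n
    by (simp add: closure_of_complement)
  then have "T closure_of (topspace T \<inter> (\<Inter>n. topspace T - T closure_of A n)) = topspace T"
    using assms(1) unfolding baire_space_def
    by (auto dest!: spec[of _ "range (\<lambda>n. topspace T - T closure_of A n)"])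
  moreover have "A n \<subseteq> T closure_of A n" for n
    using assms(3) by (intro closure_of_subset) auto
  then have "topspace T \<inter> (\<Inter>n. topspace T - T closure_of A n) = {}"
    using assms(3) by blast
  ultimately show False
    using assms(2) by (metis closure_of_empty)
qed

text \<open>The radius does not depend on the second metric \<open>\<delta>\<close>: some identity neighbourhood is
  coarsely bounded.\<close>

lemma bounded_ball:
  fixes G (structure)
  assumes "group G" and d: "compatible_metric G T d" "left_invariant G d"
    and "baire_space T" and B: "coarsely_bounded G T B" and gen: "generate G B = carrier G"
  shows "\<exists>e>0. \<forall>\<delta>. compatible_metric G T \<delta> \<and> left_invariant G \<delta> \<longrightarrow>
    (\<exists>M. \<forall>x\<in>Metric_space.mball (carrier G) d \<one> e. \<delta> \<one> x \<le> M)"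
proof -
  interpret left_invariant_metric_group G d
    using left_invariant_metric_groupI assms by blast
  have T: "mtopology = T"
    using d(1) by (simp add: compatible_metric_def)
  then have top: "topspace T = carrier G"
    using topspace_mtopology by simp
  define S where "S = B \<union> m_inv G ` B"
  have B_carrier: "B \<subseteq> carrier G"
    using B by (simp add: coarsely_bounded_def)
  then have S: "S \<subseteq> carrier G" "\<And>s. s \<in> S \<Longrightarrow> inv s \<in> S"
    by (auto simp: S_def subsetD)
  define A where "A n = {g. \<exists>r\<le>real n. word_cost G S (\<lambda>_. 1) g r}" for n
  have "\<exists>n. g \<in> A n" if g: "g \<in> carrier G" for g
  proof -
    have "g \<in> generate G S"
      using g gen mono_generate[of B S] by (auto simp: S_def)
    then obtain r where "word_cost G S (\<lambda>_. 1) g r"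
      using word_cost_total S by blast
    then show ?thesis
      using real_arch_simple[of r] by (auto simp: A_def)
  qed
  moreover have A_carrier: "A n \<subseteq> carrier G" for n
    using word_cost_closed S(1) by (auto simp: A_def)
  ultimately have "topspace T = (\<Union>n. A n)"
    unfolding top by (intro equalityI subsetI) auto
  moreover have "topspace T \<noteq> {}"
    unfolding top using one_closed by blast
  ultimately obtain n where "T interior_of (T closure_of A n) \<noteq> {}"
    using baire_space_countable_cover[OF \<open>baire_space T\<close>, of A] by blast
  then obtain p where p: "p \<in> T interior_of (T closure_of A n)"
    by blast
  moreover have "openin mtopology (T interior_of (T closure_of A n))"
    using T by simp
  ultimately obtain e where "e > 0"
    and e: "mball p e \<subseteq> T interior_of (T closure_of A n)" and pG: "p \<in> carrier G"
    unfolding openin_mtopology by blast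
  have "\<exists>M. \<forall>x\<in>mball \<one> e. \<delta> \<one> x \<le> M"
    if \<delta>: "compatible_metric G T \<delta>" "left_invariant G \<delta>" for \<delta>
  proof -
    interpret \<delta>: left_invariant_metric_group G \<delta>
      using left_invariant_metric_groupI \<delta> is_group by blast
    obtain C0 where C0: "\<And>x. x \<in> B \<Longrightarrow> \<delta> \<one> x \<le> C0"
      using coarsely_bounded_imp_norm_bounded[OF is_group B \<delta>] by blast
    \<comment> \<open>\<open>C0\<close> may be negative if \<open>B\<close> is empty, but \<open>C * r\<close> has to be monotone in \<open>r\<close>.\<close>
    define C where "C = max C0 0"
    have "\<delta> \<one> s \<le> C * 1" if "s \<in> S" for s
      using that C0 B_carrier by (auto simp: S_def C_def \<delta>.norm_inv subsetD le_max_iff_disj)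
    then have "\<delta> \<one> g \<le> C * real n" if g: "g \<in> A n" for g
    proof -
      obtain r where r: "r \<le> real n" "word_cost G S (\<lambda>_. 1) g r"
        using g by (auto simp: A_def)
      have "\<delta> \<one> g \<le> C * r"
        by (rule \<delta>.norm_le_word_cost[OF r(2) S(1)]) fact
      also have "\<dots> \<le> C * real n"
        using r(1) by (intro mult_left_mono) (auto simp: C_def)
      finally show ?thesis .
    qed
    then have "A n \<subseteq> \<delta>.mcball \<one> (C * real n)"
      using A_carrier[of n] by auto
    moreover have "closedin T (\<delta>.mcball \<one> (C * real n))"
      using \<delta>.closedin_mcball \<delta>(1) unfolding compatible_metric_def by metis
    ultimately have cl: "T closure_of A n \<subseteq> \<delta>.mcball \<one> (C * real n)"
      by (rule closure_of_minimal)
    have "\<delta> \<one> x \<le> \<delta> \<one> p + C * real n" if "x \<in> mball \<one> e" for x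
    proof -
      have x: "x \<in> carrier G"
        using that by simp
      \<comment> \<open>Left translation by \<open>p\<close> moves the ball about \<open>\<one>\<close> into the closure of \<open>A n\<close>.\<close>
      have "p \<otimes> x \<in> mball p e"
        using dist_mult_left[of p \<one> x] that pG by simp
      then have "p \<otimes> x \<in> T closure_of A n"
        by (rule subsetD[OF order.trans[OF e interior_of_subset]])
      then have "\<delta> \<one> (p \<otimes> x) \<le> C * real n"
        using cl by auto
      then show ?thesis
        using \<delta>.dist_mult_left[of p \<one> x] \<delta>.triangle''[of p \<one> "p \<otimes> x"] pG x
        by simp
    qed
    then show ?thesis by blast
  qed
  then show ?thesis
    using \<open>e > 0\<close> by blast
qed

section \<open>Existence and uniqueness\<close>

lemma ex_maximal_minimal_metric:
  fixes G (structure)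
  assumes "group G" "baire_space T" "coarsely_bounded G T B" "generate G B = carrier G"
    and d: "minimal_metric G T d"
  shows "\<exists>D. maximal_metric G T D \<and> minimal_metric G T D"
proof -
  have cd: "compatible_metric G T d" "left_invariant G d"
    using d by (simp_all add: minimal_metric_def)
  interpret left_invariant_metric_group G d
    using left_invariant_metric_groupI assms cd by blast
  have T: "mtopology = T"
    using cd(1) by (simp add: compatible_metric_def)
  obtain e where "e > 0" and e: "\<And>\<delta>. \<lbrakk>compatible_metric G T \<delta>; left_invariant G \<delta>\<rbrakk> \<Longrightarrow>
      \<exists>M. \<forall>x\<in>mball \<one> e. \<delta> \<one> x \<le> M"
    using bounded_ball[OF is_group cd assms(2-4)] by blast
  define W where "W = mball \<one> e \<union> B \<union> m_inv G ` B"
  have B: "B \<subseteq> carrier G"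
    using assms(3) by (simp add: coarsely_bounded_def)
  then have W: "W \<subseteq> carrier G"
    by (auto simp: W_def)
  interpret chain_metric G d W e
  proof
    show "inv w \<in> W" if "w \<in> W" for w
      using that B by (auto simp: W_def norm_inv subsetD)
    show "generate G W = carrier G"
      using generate_incl[OF W] mono_generate[of B W] assms(4) by (auto simp: W_def)
  qed (use W \<open>e > 0\<close> in \<open>auto simp: W_def\<close>)
  have "\<exists>M. \<forall>w\<in>W. \<delta> \<one> w \<le> M"
    if \<delta>: "compatible_metric G T \<delta>" "left_invariant G \<delta>" for \<delta>
  proof -
    interpret \<delta>: left_invariant_metric_group G \<delta>
      using left_invariant_metric_groupI \<delta> is_group by blast
    obtain M where M: "\<And>x. x \<in> mball \<one> e \<Longrightarrow> \<delta> \<one> x \<le> M"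
      using e \<delta> by blast
    obtain C where C: "\<And>x. x \<in> B \<Longrightarrow> \<delta> \<one> x \<le> C"
      using coarsely_bounded_imp_norm_bounded[OF is_group assms(3) \<delta>] by blast
    have "\<delta> \<one> w \<le> max M C" if "w \<in> W" for w
      using that M[of w] C B unfolding W_def
      by (auto simp: \<delta>.norm_inv subsetD le_max_iff_disj)
    then show ?thesis by blast
  qed
  then show ?thesis
    using maximal_chain_dist minimal_chain_dist d unfolding T by blast
qed

lemma minimal_le_maximal:
  fixes G (structure)
  assumes "group G" and d: "minimal_metric G T d" and \<delta>: "maximal_metric G T \<delta>"
  shows "\<exists>L. \<forall>x\<in>carrier G. \<forall>y\<in>carrier G. d x y \<le> L * \<delta> x y"
proof -
  have cd: "compatible_metric G T d" "left_invariant G d"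
    using d by (simp_all add: minimal_metric_def)
  have c\<delta>: "compatible_metric G T \<delta>" "left_invariant G \<delta>"
    using \<delta> by (simp_all add: maximal_metric_def)
  interpret left_invariant_metric_group G d
    using left_invariant_metric_groupI assms cd by blast
  interpret \<delta>: left_invariant_metric_group G \<delta>
    using left_invariant_metric_groupI assms c\<delta> by blast
  obtain U K1 where U: "identity_neighbourhood G T U"
    and K1: "\<And>g f. \<lbrakk>g \<in> U; f \<in> U\<rbrakk> \<Longrightarrow> d g f \<le> K1 * \<delta> g f"
    using d c\<delta> unfolding minimal_metric_def by blast
  obtain K2 C where K2:
    "\<And>g f. \<lbrakk>g \<in> carrier G; f \<in> carrier G\<rbrakk> \<Longrightarrow> d g f \<le> K2 * \<delta> g f + C"
    using \<delta> cd unfolding maximal_metric_def by blast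
  obtain e where "e > 0" and e: "\<delta>.mball \<one> e \<subseteq> U"
  proof -
    obtain N where N: "openin T N" "\<one> \<in> N" "N \<subseteq> U"
      using U unfolding identity_neighbourhood_def by blast
    have "\<delta>.mtopology = T"
      using c\<delta>(1) by (simp add: compatible_metric_def)
    with N(1) have "openin \<delta>.mtopology N"
      by simp
    with N(2) obtain r where "r > 0" "\<delta>.mball \<one> r \<subseteq> N"
      unfolding \<delta>.openin_mtopology by blast
    then show thesis
      using that N(3) by blast
  qed
  define L where "L = max K1 (K2 + \<bar>C\<bar> / e)"
  have L: "K1 \<le> L" "K2 + \<bar>C\<bar> / e \<le> L"
    by (simp_all add: L_def)
  have norm: "d \<one> x \<le> L * \<delta> \<one> x" if x: "x \<in> carrier G" for x
  proof (cases "\<delta> \<one> x < e")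
    case True
    then have "d \<one> x \<le> K1 * \<delta> \<one> x"
      using x e \<open>e > 0\<close> by (intro K1) (auto simp: subset_iff)
    also have "\<dots> \<le> L * \<delta> \<one> x"
      using L by (intro mult_right_mono) auto
    finally show ?thesis .
  next
    case False
    have "C \<le> \<bar>C\<bar> / e * e"
      using \<open>e > 0\<close> by simp
    also have "\<dots> \<le> \<bar>C\<bar> / e * \<delta> \<one> x"
      using False \<open>e > 0\<close> by (intro mult_left_mono) auto
    finally have "C \<le> \<bar>C\<bar> / e * \<delta> \<one> x" .
    then have "d \<one> x \<le> (K2 + \<bar>C\<bar> / e) * \<delta> \<one> x"
      using K2[of \<one> x] x by (simp add: distrib_right)
    also have "\<dots> \<le> L * \<delta> \<one> x"
      using L by (intro mult_right_mono) auto
    finally show ?thesis .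
  qed
  have "d x y \<le> L * \<delta> x y" if "x \<in> carrier G" "y \<in> carrier G" for x y
    using norm[of "inv x \<otimes> y"] dist_eq_norm[of x y] \<delta>.dist_eq_norm[of x y] that by simp
  then show ?thesis by blast
qed

lemma minimal_maximal_bi_Lipschitz:
  assumes "group G" "minimal_metric G T d" "maximal_metric G T d"
    "minimal_metric G T \<delta>" "maximal_metric G T \<delta>"
  shows "bi_Lipschitz_equivalent_on (carrier G) d \<delta>"
proof -
  interpret d: Metric_space "carrier G" d
    using assms(2) by (simp add: minimal_metric_def compatible_metric_def)
  interpret \<delta>: Metric_space "carrier G" \<delta>
    using assms(4) by (simp add: minimal_metric_def compatible_metric_def)
  obtain L1 where L1: "\<And>x y. \<lbrakk>x \<in> carrier G; y \<in> carrier G\<rbrakk> \<Longrightarrow> d x y \<le> L1 * \<delta> x y"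
    using minimal_le_maximal[of G T d \<delta>] assms by blast
  obtain L2 where L2: "\<And>x y. \<lbrakk>x \<in> carrier G; y \<in> carrier G\<rbrakk> \<Longrightarrow> \<delta> x y \<le> L2 * d x y"
    using minimal_le_maximal[of G T \<delta> d] assms by blast
  define L where "L = max 1 (max L1 L2)"
  have L: "L > 0" "L1 \<le> L" "L2 \<le> L"
    by (auto simp: L_def)
  have "1 / L * d x y \<le> \<delta> x y \<and> \<delta> x y \<le> L * d x y"
    if "x \<in> carrier G" "y \<in> carrier G" for x y
  proof
    have "d x y \<le> L * \<delta> x y"
      using L1[OF that] mult_right_mono[OF L(2), of "\<delta> x y"] by simp
    then show "1 / L * d x y \<le> \<delta> x y"
      using L(1) by (simp add: field_simps)
    show "\<delta> x y \<le> L * d x y"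
      using L2[OF that] mult_right_mono[OF L(3), of "d x y"] by simp
  qed
  then show ?thesis
    using L(1) unfolding bi_Lipschitz_equivalent_on_def by blast
qed

theorem theorem10:
  fixes G :: "('a, 'b) monoid_scheme" and T :: "'a topology"
  assumes "polish_group G T \<or> european_group G T"
    and "\<exists>B. coarsely_bounded G T B \<and> generate G B = carrier G"
    and "\<exists>d. minimal_metric G T d"
  shows "(\<exists>d. maximal_metric G T d \<and> minimal_metric G T d) \<and>
         well_defined_Lipschitz_geometry G T"
proof -
  have "topological_group G T"
    using assms(1) polish_group.axioms(1) european_group.axioms(1) by blast
  then have G: "group G"
    by (rule topological_group.axioms(1))
  have "baire_space T"
    using assms(1) polish_group_imp_baire_space european_group.baire by blast
  then have "\<exists>d. maximal_metric G T d \<and> minimal_metric G T d"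
    using ex_maximal_minimal_metric[OF G] assms(2,3) by blast
  then show ?thesis
    unfolding well_defined_Lipschitz_geometry_def
    using minimal_maximal_bi_Lipschitz[OF G] by blast
qed

end
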